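(* Let $m\ge 1$ be an integer, let $J,K\subseteq\{0,1,\ldots,m-1\}$ be nonempty with $|J|=|K|$, and let $A$ be a set of nonnegative integers such that $K\oplus A$ contains exactly one representative from each congruence class modulo $m$. If for all $s\in\mathcal{P}_m(J)\setminus\{1\}$ the cyclotomic polynomial $\Phi_s(z)$ does not divide $A(z)$, then $H_{J,K}$ is a Hadamard submatrix of $\mathcal{F}_m$.
   Context: $\mathcal{F}_m=(e^{2\pi i jk/m})_{0\le j,k\le m-1}$ is the $m\times m$ Fourier matrix. For $J,K\subseteq\{0,\ldots,m-1\}$ with $|J|=|K|=n$, $H_{J,K}=H_{J,K,m}=(e^{2\pi i jk/m})_{j\in J,k\in K}$ is the $n\times n$ submatrix of $\mathcal{F}_m$ with rows $J$ and columns $K$ (each listed in increasing order). An $n\times n$ complex matrix $H$ is Hadamard if all its entries have modulus $1$ and $H^*H=HH^*=nI_n$. $K\oplus A$ denotes the set of sums $\{k+a:k\in K,a\in A\}$, the notation $\oplus$ meaning that each element of it has a unique representation $k+a$ with $k\in K$, $a\in A$. $A(z)=\sum_{a\in A}z^a$ (the condition on $K\oplus A$ forces $A$ to be finite). $\Phi_s(z)$ is the $s$-th cyclotomic polynomial. For a nonempty finite set $X$ of nonnegative integers, $\mathcal{D}(X)=\{x_1-x_2:x_1,x_2\in X\}$ and $\mathcal{P}_m(X)=\left\{\frac{m}{\gcd(m,d)}:d\in\mathcal{D}(X)\right\}$ (with $\gcd(m,0)=m$). *)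

theory Defs
  imports
    Complex_Main
    "HOL-Library.Set_Algebras"
    "HOL-Number_Theory.Cong"
    "HOL-Computational_Algebra.Polynomial"
    "Jordan_Normal_Form.DL_Submatrix"
    "Jordan_Normal_Form.Schur_Decomposition"
begin

definition fourier_mat :: "nat \<Rightarrow> complex mat" where
  "fourier_mat m = mat m m (\<lambda>(j, k). exp (2 * of_real pi * \<i> * of_nat j * of_nat k / of_nat m))"

text \<open>\<^const>\<open>submatrix\<close> keeps the rows in \<open>J\<close> and the columns in \<open>K\<close>, each in increasing order.\<close>

abbreviation fourier_submat :: "nat \<Rightarrow> nat set \<Rightarrow> nat set \<Rightarrow> complex mat" where
  "fourier_submat m J K \<equiv> submatrix (fourier_mat m) J K"

definition hadamard_mat :: "nat \<Rightarrow> complex mat \<Rightarrow> bool" where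
  "hadamard_mat n H \<longleftrightarrow>
     H \<in> carrier_mat n n \<and>
     (\<forall>i<n. \<forall>j<n. cmod (H $$ (i, j)) = 1) \<and>
     mat_adjoint H * H = of_nat n \<cdot>\<^sub>m 1\<^sub>m n \<and>
     H * mat_adjoint H = of_nat n \<cdot>\<^sub>m 1\<^sub>m n"

definition unique_sums :: "nat set \<Rightarrow> nat set \<Rightarrow> bool" where
  "unique_sums K A \<longleftrightarrow> (\<forall>x\<in>K + A. \<exists>!p. p \<in> K \<times> A \<and> x = fst p + snd p)"

definition complete_residue_system :: "nat \<Rightarrow> nat set \<Rightarrow> bool" where
  "complete_residue_system m S \<longleftrightarrow> (\<forall>r. \<exists>!x. x \<in> S \<and> [x = r] (mod m))"

text \<open>The hypotheses on \<open>K + A\<close> force \<open>A\<close> to be finite, so that \<open>set_poly A\<close> below is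
  the intended polynomial and not the default value of a sum over an infinite set.\<close>

lemma complete_residue_system_finite:
  assumes "m \<ge> 1" "K \<noteq> {}" "complete_residue_system m (K + A)"
  shows "finite A"
proof -
  obtain k where k: "k \<in> K" using assms(2) by blast
  have "inj_on (\<lambda>x. x mod m) (K + A)"
    using assms(3) unfolding complete_residue_system_def cong_def inj_on_def by metis
  moreover have "(\<lambda>x. x mod m) ` (K + A) \<subseteq> {..<m}" using assms(1) by auto
  ultimately have "finite (K + A)" using finite_lessThan inj_on_finite by blast
  moreover have "(\<lambda>a. k + a) ` A \<subseteq> K + A" using k by (auto intro: set_plus_intro)
  ultimately have "finite ((\<lambda>a. k + a) ` A)" by (rule rev_finite_subset)
  then show ?thesis by (rule finite_imageD) simp
qed

definition set_poly :: "nat set \<Rightarrow> complex poly" where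
  "set_poly A = (\<Sum>a\<in>A. monom 1 a)"

text \<open>The cyclotomic polynomial is taken in \<open>\<complex>[z]\<close>; as it is monic with integer
  coefficients, divisibility of an integer polynomial by it does not depend on whether it is
  read over the integers, the rationals or the complex numbers.\<close>

definition cyclotomic_poly :: "nat \<Rightarrow> complex poly" where
  "cyclotomic_poly s =
     (\<Prod>k\<in>{k\<in>{1..s}. coprime k s}. [:- exp (2 * of_real pi * \<i> * of_nat k / of_nat s), 1:])"

definition difference_set :: "nat set \<Rightarrow> int set" where
  "difference_set X = {int x1 - int x2 | x1 x2. x1 \<in> X \<and> x2 \<in> X}"

definition period_set :: "nat \<Rightarrow> nat set \<Rightarrow> nat set" where
  "period_set m X = {m div nat (gcd (int m) d) | d. d \<in> difference_set X}"

end

theory Submission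
  imports Defs
begin

text \<open>
  The matrix \<open>H = fourier_submat m J K\<close> has unimodular entries and is square, so it is Hadamard as soon as its
  rows are pairwise orthogonal (\<open>hadamard_matI_rows\<close>). Write \<open>K(z)\<close> for the sum of \<open>z ^ k\<close> over
  \<open>k \<in> K\<close>. The inner product of the rows \<open>j \<noteq> j'\<close> is \<open>K(w)\<close>, where \<open>w\<close> is the \<open>m\<close>-th root of
  unity with exponent \<open>j - j'\<close>; its order is the element \<open>s = m / gcd(m, j - j')\<close> of
  \<open>period_set m J\<close>, and \<open>s > 1\<close> because \<open>0 < \<bar>j - j'\<bar> < m\<close>.

  Since \<open>K + A\<close> runs once through the residues modulo \<open>m\<close>, the product \<open>K(u) A(u)\<close> equals
  \<open>1 + u + \<dots> + u ^ (m - 1) = 0\<close> at every \<open>m\<close>-th root of unity \<open>u \<noteq> 1\<close>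
  (\<open>root_of_unity_exponential_sums_product\<close>). As the cyclotomic polynomial of order \<open>s\<close> does not
  divide \<open>A(z)\<close>, some primitive \<open>s\<close>-th root of unity \<open>u\<close> has \<open>A(u) \<noteq> 0\<close>, hence \<open>K(u) = 0\<close>.
  This \<open>u\<close> need not be \<open>w\<close>, but \<open>w = u ^ t\<close> with \<open>t\<close> coprime to \<open>s\<close>, so \<open>K(w) = 0\<close> follows from the
  fact that an integer polynomial vanishing at a root of unity vanishes at all its conjugates.

  That fact (\<open>int_poly_vanishes_at_conjugate_root_of_unity\<close>), which amounts to the irreducibility
  of cyclotomic polynomials over the rationals, is the arithmetical heart of the proof. The
  argument is Landau's. Let \<open>Q\<close> be an integer polynomial and \<open>w\<close> an \<open>s\<close>-th root of unity. For a
  prime \<open>p\<close>, the polynomials \<open>Q(X ^ p)\<close> and \<open>Q(X) ^ p\<close> agree modulo \<open>p\<close>, so \<open>Q(w ^ k) = 0\<close> makes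
  \<open>Q(w ^ (k * p))\<close> a multiple of \<open>p\<close> in the ring \<open>\<int>[w]\<close>. There are only finitely many numbers
  \<open>Q(w ^ k)\<close>, and a nonzero element of \<open>\<int>[w]\<close> is divisible by only finitely many integers
  (\<open>root_of_unity_ring_divisors_bounded\<close>); so \<open>Q(w ^ (k * p)) = 0\<close> for all primes \<open>p\<close> outside a
  finite set. Finally every \<open>t\<close> coprime to \<open>s\<close> is congruent modulo \<open>s\<close> to a product of such primes
  (\<open>exists_cong_coprime\<close>).
\<close>

section \<open>Vanishing of integer polynomials at conjugate roots of unity\<close>

lemma prime_dvd_freshmans_dream:
  fixes x y :: "'a :: comm_ring_1"
  assumes "prime p"
  shows "of_nat p dvd (x + y) ^ p - (x ^ p + y ^ p)"
proof -
  have p: "p > 1" using assms by (rule prime_gt_1_nat)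
  define t where "t k = of_nat (p choose k) * x ^ k * y ^ (p - k)" for k
  have "(x + y) ^ p = (\<Sum>k\<le>p. t k)"
    unfolding t_def by (rule binomial_ring)
  also have "{..p} = insert 0 (insert p {0<..<p})"
    using p by auto
  also have "(\<Sum>k\<in>\<dots>. t k) = y ^ p + x ^ p + (\<Sum>k\<in>{0<..<p}. t k)"
    using p by (simp add: t_def)
  finally have eq: "(x + y) ^ p - (x ^ p + y ^ p) = (\<Sum>k\<in>{0<..<p}. t k)"
    by simp
  have "of_nat p dvd t k" if "k \<in> {0<..<p}" for k
  proof -
    have "p dvd (p choose k)"
      using that assms by (intro dvd_choose_prime) auto
    then have "(of_nat p :: 'a) dvd of_nat (p choose k)"
      by (auto elim!: dvdE)
    then show ?thesis
      unfolding t_def by simp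
  qed
  then show ?thesis
    unfolding eq by (rule dvd_sum)
qed

lemma prime_dvd_power_minus_self_int:
  fixes c :: int
  assumes "prime p"
  shows "int p dvd c ^ p - c"
proof -
  have p0: "p > 0" using assms by (rule prime_gt_0_nat)
  have nat_case: "int p dvd int n ^ p - int n" for n
  proof (induction n)
    case 0
    then show ?case using p0 by (simp add: power_0_left)
  next
    case (Suc n)
    have "int p dvd (int n + 1) ^ p - (int n ^ p + 1 ^ p)"
      using prime_dvd_freshmans_dream[OF assms, of "int n" 1] by simp
    from dvd_add[OF this Suc] show ?case
      by (simp add: algebra_simps)
  qed
  define n where "n = nat (c mod int p)"
  have "[c = int n] (mod int p)"
    using p0 by (simp add: n_def cong_def)
  then have "[c ^ p - c = int n ^ p - int n] (mod int p)"
    by (intro cong_diff cong_pow)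
  then show ?thesis
    using nat_case[of n] by (simp add: cong_dvd_iff)
qed

text \<open>
  By induction on the coefficients: \<open>c + X Q\<close> is raised to the power \<open>p\<close> termwise modulo \<open>p\<close>, and
  \<open>c ^ p\<close> is \<open>c\<close> by Fermat's little theorem.
\<close>

lemma prime_dvd_poly_frobenius:
  fixes Q :: "int poly"
  assumes "prime p"
  shows "of_nat p dvd Q ^ p - pcompose Q (monom 1 p)"
proof (induction Q)
  case 0
  then show ?case
    using prime_gt_0_nat[OF assms] by (simp add: power_0_left)
next
  case (pCons c Q)
  let ?X = "monom 1 1 :: int poly" and ?Y = "monom 1 p :: int poly"
  have 1: "of_nat p dvd ([:c:] + ?X * Q) ^ p - ([:c:] ^ p + (?X * Q) ^ p)"
    by (rule prime_dvd_freshmans_dream[OF assms])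
  have "[:c:] ^ p - [:c:] = [:c ^ p - c:]"
    by (simp add: poly_const_pow)
  moreover obtain d where "c ^ p - c = int p * d"
    using prime_dvd_power_minus_self_int[OF assms] by (rule dvdE)
  ultimately have "[:c:] ^ p - [:c:] = of_nat p * [:d:]"
    by (simp add: of_nat_poly)
  then have 2: "of_nat p dvd [:c:] ^ p - [:c:]"
    by (metis dvd_triv_left)
  have 3: "of_nat p dvd ?Y * (Q ^ p - pcompose Q ?Y)"
    using pCons.IH by simp
  have XY: "(?X * Q) ^ p = ?Y * Q ^ p"
    by (simp add: power_mult_distrib monom_power)
  have split: "pCons c Q = [:c:] + ?X * Q"
    by (simp add: monom_altdef)
  have "pCons c Q ^ p - pcompose (pCons c Q) ?Y =
      (([:c:] + ?X * Q) ^ p - ([:c:] ^ p + (?X * Q) ^ p)) + ([:c:] ^ p - [:c:])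
        + ?Y * (Q ^ p - pcompose Q ?Y)"
    unfolding XY pcompose_pCons split[symmetric] by (simp add: algebra_simps)
  then show ?case
    using dvd_add[OF dvd_add[OF 1 2] 3] by simp
qed

abbreviation eval_int_poly :: "int poly \<Rightarrow> complex \<Rightarrow> complex" where
  "eval_int_poly Q z \<equiv> poly (map_poly of_int Q) z"

lemma eval_int_poly_frobenius:
  assumes "prime p"
  shows "\<exists>R. eval_int_poly Q (z ^ p) = eval_int_poly Q z ^ p + of_nat p * eval_int_poly R z"
proof -
  obtain R where "Q ^ p - pcompose Q (monom 1 p) = of_nat p * R"
    using prime_dvd_poly_frobenius[OF assms] by (rule dvdE)
  then have R: "pcompose Q (monom 1 p) = Q ^ p + of_nat p * (- R)"
    by (simp add: algebra_simps)
  have "eval_int_poly (pcompose Q (monom 1 p)) z = eval_int_poly Q (z ^ p)"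
    by (simp add: of_int_hom.map_poly_pcompose poly_pcompose poly_monom of_int_hom.map_poly_hom_monom)
  moreover have "eval_int_poly (Q ^ p + of_nat p * (- R)) z =
      eval_int_poly Q z ^ p + of_nat p * eval_int_poly (- R) z"
    by (simp add: hom_distribs of_nat_poly)
  ultimately show ?thesis
    unfolding R by metis
qed

text \<open>
  The complex numbers form a vector space over the rationals, in which a nonzero vector is
  independent, so that a linear functional with a prescribed value there exists.
\<close>

lemma exists_rat_linear_functional:
  fixes x :: complex
  assumes "x \<noteq> 0"
  shows "\<exists>\<phi> :: complex \<Rightarrow> rat. \<phi> x = 1 \<and> (\<forall>y z. \<phi> (y + z) = \<phi> y + \<phi> z) \<and>
           (\<forall>r y. \<phi> (of_rat r * y) = r * \<phi> y)"
proof -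
  interpret V: vector_space_pair "\<lambda>(r::rat) (z::complex). of_rat r * z" "\<lambda>(r::rat) (q::rat). r * q"
    by unfold_locales (simp_all add: algebra_simps of_rat_add of_rat_mult)
  have "V.vs1.independent {x}"
    using assms by simp
  from V.linear_independent_extend[OF this, of "\<lambda>_. 1"] obtain \<phi> where
    \<phi>: "Vector_Spaces.linear (\<lambda>r z. of_rat r * z) (\<lambda>r q. r * q) \<phi>" and x: "\<phi> x = 1"
    by auto
  interpret \<phi>: Vector_Spaces.linear "\<lambda>(r::rat) (z::complex). of_rat r * z" "\<lambda>(r::rat) (q::rat). r * q" \<phi>
    by (fact \<phi>)
  show ?thesis
    using x \<phi>.add \<phi>.scale by blast
qed

lemma root_of_unity_power_cong:
  fixes w :: complex
  assumes "w ^ s = 1" "[i = j] (mod s)"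
  shows "w ^ i = w ^ j"
proof -
  have "w ^ n = w ^ (n mod s)" for n
  proof -
    have "w ^ n = w ^ (s * (n div s) + n mod s)" by simp
    also have "\<dots> = w ^ (n mod s)" 
      unfolding power_add power_mult assms(1) by simp
    finally show ?thesis .
  qed
  then show ?thesis
    using assms(2) unfolding cong_def by metis
qed

text \<open>
  A rational linear functional \<open>\<phi>\<close> with \<open>\<phi> x = 1\<close> takes values with bounded denominator on the
  ring \<open>\<int>[w]\<close>, because this ring is spanned over the integers by the \<open>s\<close> powers of \<open>w\<close>. If \<open>D\<close> is a
  common denominator and \<open>x = p z\<close> with \<open>z \<in> \<int>[w]\<close>, then \<open>D = D \<phi>(x) = p (D \<phi>(z))\<close>, whence
  \<open>p\<close> divides \<open>D\<close>.
\<close>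

lemma root_of_unity_ring_divisors_bounded:
  fixes w x :: complex
  assumes s: "s > 0" "w ^ s = 1" and x: "x \<noteq> 0"
  shows "\<exists>D>0. \<forall>p R. x = of_nat p * eval_int_poly R w \<longrightarrow> p dvd D"
proof -
  obtain \<phi> :: "complex \<Rightarrow> rat" where \<phi>: "\<phi> x = 1"
    "\<And>y z. \<phi> (y + z) = \<phi> y + \<phi> z" "\<And>r y. \<phi> (of_rat r * y) = r * \<phi> y"
    using exists_rat_linear_functional[OF x] by blast
  have \<phi>0: "\<phi> 0 = 0"
    using \<phi>(3)[of 0 0] by simp
  have \<phi>int: "\<phi> (of_int c * y) = of_int c * \<phi> y" for c y
    using \<phi>(3)[of "of_int c" y] by simp
  define d where "d i = snd (quotient_of (\<phi> (w ^ i)))" for i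
  define D where "D = (\<Prod>i<s. d i)"
  have dpos: "d i > 0" for i
    unfolding d_def by (rule quotient_of_denom_pos')
  have d: "of_int (d i) * \<phi> (w ^ i) \<in> \<int>" for i
  proof -
    obtain a b where ab: "quotient_of (\<phi> (w ^ i)) = (a, b)" by fastforce
    then have "b > 0" "\<phi> (w ^ i) = of_int a / of_int b"
      by (auto intro: quotient_of_denom_pos quotient_of_div)
    with ab show ?thesis by (simp add: d_def)
  qed
  have D: "of_int D * \<phi> (w ^ i) \<in> \<int>" for i
  proof -
    have wi: "w ^ i = w ^ (i mod s)"
      by (rule root_of_unity_power_cong[OF s(2)]) (simp add: cong_def)
    have "d (i mod s) dvd D"
      unfolding D_def using s(1) by (intro dvd_prodI) auto
    then obtain e where "D = d (i mod s) * e" by (rule dvdE)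
    then have "of_int D * \<phi> (w ^ i) = of_int e * (of_int (d (i mod s)) * \<phi> (w ^ (i mod s)))"
      by (simp add: wi)
    then show ?thesis using d[of "i mod s"] by simp
  qed
  have R: "of_int D * \<phi> (w ^ i * eval_int_poly R w) \<in> \<int>" for R i
  proof (induction R arbitrary: i)
    case 0
    then show ?case by (simp add: \<phi>0)
  next
    case (pCons c R)
    have "w ^ i * eval_int_poly (pCons c R) w =
        of_int c * w ^ i + w ^ Suc i * eval_int_poly R w"
      by (simp add: hom_distribs algebra_simps)
    then have "of_int D * \<phi> (w ^ i * eval_int_poly (pCons c R) w) =
        of_int c * (of_int D * \<phi> (w ^ i)) + of_int D * \<phi> (w ^ Suc i * eval_int_poly R w)"
      by (simp only: \<phi>(2) \<phi>int) (simp add: algebra_simps)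
    then show ?case
      using D[of i] pCons.IH[of "Suc i"] by simp
  qed
  have Dpos: "D > 0"
    unfolding D_def using dpos by (simp add: prod_pos)
  have "p dvd nat D" if "x = of_nat p * eval_int_poly R w" for p R
  proof -
    have "1 = of_nat p * \<phi> (eval_int_poly R w)"
      using \<phi>(1) \<phi>int[of "int p"] that by simp
    moreover obtain a where "of_int D * \<phi> (eval_int_poly R w) = of_int a"
      using R[of 0 R] by (auto elim: Ints_cases)
    ultimately have "(of_int D :: rat) = of_nat p * of_int a"
      by (metis mult.assoc mult.commute mult_1)
    then have "D = int p * a"
      by (metis of_int_eq_iff of_int_mult of_int_of_nat_eq)
    then show ?thesis
      using Dpos by (metis dvd_triv_left int_dvd_int_iff int_nat_eq less_imp_le)
  qed
  then show ?thesis
    using Dpos by (intro exI[of _ "nat D"]) auto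
qed

text \<open>
  The witness is \<open>t + s M\<close> with \<open>M\<close> the product of the primes that divide \<open>D\<close> but not \<open>t\<close>: a prime
  divisor of \<open>D\<close> divides exactly one of the two summands, as those that divide \<open>t\<close> do not divide \<open>s\<close>.
\<close>

lemma exists_cong_coprime:
  fixes s t D :: nat
  assumes "coprime t s" "s > 0" "D > 0"
  shows "\<exists>t'. [t' = t] (mod s) \<and> t' > 0 \<and> coprime t' D"
proof -
  define M where "M = \<Prod>{q. prime q \<and> q dvd D \<and> \<not> q dvd t}"
  have fin: "finite {q. prime q \<and> q dvd D \<and> \<not> q dvd t}"
    using assms(3) by (rule_tac finite_subset[of _ "{..D}"]) (auto intro: dvd_imp_le)
  have "coprime (t + s * M) D"
  proof (rule ccontr)
    assume "\<not> coprime (t + s * M) D"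
    then obtain q where q: "prime q" "q dvd t + s * M" "q dvd D"
      using prime_factor_nat[of "gcd (t + s * M) D"] by (auto simp: coprime_iff_gcd_eq_1)
    show False
    proof (cases "q dvd t")
      case True
      then have "q dvd s * M" using q(2) by (simp add: dvd_add_right_iff)
      moreover have "\<not> q dvd s"
        using True q(1) assms(1) by (metis coprime_common_divisor_nat not_prime_1)
      ultimately have "q dvd M" using q(1) by (simp add: prime_dvd_mult_iff)
      then obtain q' where "prime q'" "\<not> q' dvd t" "q dvd q'"
        using q(1) fin unfolding M_def by (auto simp: prime_dvd_prod_iff)
      then show False using True q(1) primes_dvd_imp_eq by blast
    next
      case False
      then have "q dvd M"
        unfolding M_def using q fin by (intro dvd_prodI[of _ _ "\<lambda>x. x"]) auto
      then have "q dvd t" using q(2) by (metis dvd_add_left_iff dvd_mult)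
      with False show False ..
    qed
  qed
  moreover have "M > 0"
    unfolding M_def by (rule prod_pos) (auto intro: prime_gt_0_nat)
  ultimately show ?thesis
    using assms(2) by (intro exI[of _ "t + s * M"]) (simp add: cong_def)
qed

text \<open>
  The number \<open>D\<close> below is a common bound, in the sense of divisibility, for the
  integers dividing a nonzero value \<open>Q(w ^ k)\<close> in \<open>\<int>[w]\<close>; as \<open>w ^ k\<close> depends only on \<open>k\<close> modulo
  \<open>s\<close>, the exponents below \<open>s\<close> suffice. Multiplying the exponent by a prime that does not divide
  \<open>D\<close> therefore preserves zeros, and \<open>t\<close> can be replaced by a product of such primes.
\<close>

theorem int_poly_vanishes_at_conjugate_root_of_unity:
  fixes w :: complex
  assumes s: "s > 0" "w ^ s = 1" and "coprime t s" and "eval_int_poly Q w = 0"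
  shows "eval_int_poly Q (w ^ t) = 0"
proof -
  let ?x = "\<lambda>k. eval_int_poly Q (w ^ k)"
  have "\<forall>k. \<exists>D>0. ?x k \<noteq> 0 \<longrightarrow> (\<forall>p R. ?x k = of_nat p * eval_int_poly R w \<longrightarrow> p dvd D)"
  proof
    fix k
    show "\<exists>D>0. ?x k \<noteq> 0 \<longrightarrow> (\<forall>p R. ?x k = of_nat p * eval_int_poly R w \<longrightarrow> p dvd D)"
      using root_of_unity_ring_divisors_bounded[OF s, of "?x k"] by (cases "?x k = 0") auto
  qed
  then obtain d where dpos: "\<And>k. d k > (0::nat)"
    and d: "\<And>k p R. ?x k \<noteq> 0 \<Longrightarrow> ?x k = of_nat p * eval_int_poly R w \<Longrightarrow> p dvd d k"
    by metis
  define D where "D = (\<Prod>k<s. d k)"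
  have Dpos: "D > 0"
    unfolding D_def using dpos by (simp add: prod_pos)
  have prime_step: "?x (k * p) = 0" if p: "prime p" "coprime p D" and k: "?x k = 0" for p k
  proof (rule ccontr)
    assume nz: "?x (k * p) \<noteq> 0"
    define j where "j = k * p mod s"
    have wj: "w ^ (k * p) = w ^ j"
      by (rule root_of_unity_power_cong[OF s(2)]) (simp add: j_def cong_def)
    obtain R where "eval_int_poly Q ((w ^ k) ^ p) =
        eval_int_poly Q (w ^ k) ^ p + of_nat p * eval_int_poly R (w ^ k)"
      using eval_int_poly_frobenius[OF p(1)] by blast
    then have "?x j = of_nat p * eval_int_poly R (w ^ k)"
      using k prime_gt_0_nat[OF p(1)] by (simp add: wj[symmetric] power_mult power_0_left)
    \<comment> \<open>The bounds \<open>d\<close> refer to the ring \<open>\<int>[w]\<close>, which contains \<open>\<int>[w ^ k]\<close>.\<close>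
    also have "eval_int_poly R (w ^ k) = eval_int_poly (pcompose R (monom 1 k)) w"
      by (simp add: of_int_hom.map_poly_pcompose poly_pcompose poly_monom of_int_hom.map_poly_hom_monom)
    finally have "p dvd d j"
      using nz d unfolding wj by blast
    moreover have "d j dvd D"
      unfolding D_def j_def using s(1) by (intro dvd_prodI) auto
    ultimately have "p dvd D" by (rule dvd_trans)
    then show False
      using p by (metis coprime_absorb_left not_prime_unit)
  qed
  have step: "?x (k * n) = 0" if "n > 0" "coprime n D" "?x k = 0" for n k
    using that
  proof (induction n arbitrary: k rule: prime_divisors_induct)
    case zero
    then show ?case by simp
  next
    case (unit n)
    then show ?case by simp
  next
    case (factor p n)
    then have "?x ((k * p) * n) = 0"
      using prime_step[of p k] by (intro factor.IH) auto
    then show ?case by (simp add: mult.assoc)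
  qed
  obtain t' where t': "[t' = t] (mod s)" "t' > 0" "coprime t' D"
    using exists_cong_coprime[OF assms(3) s(1) Dpos] by blast
  have "?x (1 * t') = 0"
    using t' assms(4) by (intro step) auto
  then show ?thesis
    using root_of_unity_power_cong[OF s(2) t'(1)] by simp
qed

section \<open>Exponential sums over the two summands\<close>

lemma prod_linear_factors_dvd:
  fixes q :: "'a :: field poly"
  assumes "finite S" "\<And>r. r \<in> S \<Longrightarrow> poly q r = 0"
  shows "(\<Prod>r\<in>S. [:-r, 1:]) dvd q"
  using assms
proof (induction S arbitrary: q rule: finite_induct)
  case empty
  then show ?case by simp
next
  case (insert r S)
  from insert.prems have "[:-r, 1:] dvd q"
    by (simp add: poly_eq_0_iff_dvd)
  then obtain q' where q: "q = [:-r, 1:] * q'" by (rule dvdE)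
  have "poly q' u = 0" if "u \<in> S" for u
    using insert.prems[of u] insert.hyps(2) that q by auto
  then have "(\<Prod>r\<in>S. [:-r, 1:]) dvd q'"
    by (rule insert.IH)
  then show ?case
    using insert.hyps unfolding q by (simp add: mult_dvd_mono del: mult_pCons_left)
qed

lemma exp_eq_cis_root_of_unity:
  "exp (2 * of_real pi * \<i> * of_nat k / of_nat s) = cis (2 * pi * real k / real s)"
  by (simp add: cis_conv_exp mult_ac)

lemma cyclotomic_dvdI:
  assumes "s > 1"
    and "\<And>k. coprime k s \<Longrightarrow> poly q (cis (2 * pi * real k / real s)) = 0"
  shows "cyclotomic_poly s dvd q"
proof -
  let ?C = "{k \<in> {1..s}. coprime k s}" and ?r = "\<lambda>k. cis (2 * pi * real k / real s)"
  have "?C \<subseteq> {..<s}"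
    using assms(1) by (auto simp: order_le_less)
  moreover have "inj_on ?r {..<s}"
    using bij_betw_roots_unity[of s] assms(1) by (simp add: bij_betw_def)
  \<comment> \<open>The exponents in \<open>?C\<close> give distinct roots, so the defining product runs over a set of roots.\<close>
  ultimately have inj: "inj_on ?r ?C"
    by (rule inj_on_subset[rotated])
  have "cyclotomic_poly s = (\<Prod>r\<in>?r ` ?C. [:-r, 1:])"
    unfolding cyclotomic_poly_def exp_eq_cis_root_of_unity prod.reindex[OF inj] by simp
  then show ?thesis
    using assms(2) by (auto intro!: prod_linear_factors_dvd)
qed

text \<open>
  The unique sums and the residue system turn the product into the geometric sum over all
  exponents below \<open>m\<close>.
\<close>

lemma root_of_unity_exponential_sums_product:
  fixes w :: complex
  assumes m: "m > 0" "w ^ m = 1" "w \<noteq> 1"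
    and "unique_sums K A" and "complete_residue_system m (K + A)"
  shows "(\<Sum>k\<in>K. w ^ k) * (\<Sum>a\<in>A. w ^ a) = 0"
proof -
  have inj: "inj_on (\<lambda>p. fst p + snd p) (K \<times> A)"
  proof (rule inj_onI)
    fix p q assume pq: "p \<in> K \<times> A" "q \<in> K \<times> A" "fst p + snd p = fst q + snd q"
    then have "fst p + snd p \<in> K + A" by auto
    with pq show "p = q"
      using assms(4) unfolding unique_sums_def by blast
  qed
  have sums: "(\<lambda>p. fst p + snd p) ` (K \<times> A) = K + A"
    by (force simp: set_plus_def)
  have bij: "bij_betw (\<lambda>x. x mod m) (K + A) {..<m}"
    unfolding bij_betw_def
  proof
    show "inj_on (\<lambda>x. x mod m) (K + A)"
      using assms(5) unfolding complete_residue_system_def cong_def inj_on_def by metis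
    show "(\<lambda>x. x mod m) ` (K + A) = {..<m}"
    proof
      show "{..<m} \<subseteq> (\<lambda>x. x mod m) ` (K + A)"
      proof
        fix r assume "r \<in> {..<m}"
        moreover obtain x where "x \<in> K + A" "[x = r] (mod m)"
          using assms(5) unfolding complete_residue_system_def by blast
        ultimately show "r \<in> (\<lambda>x. x mod m) ` (K + A)"
          by (force simp: cong_def)
      qed
    qed (use m(1) in auto)
  qed
  have "(\<Sum>k\<in>K. w ^ k) * (\<Sum>a\<in>A. w ^ a) = (\<Sum>p\<in>K \<times> A. w ^ (fst p + snd p))"
    by (simp add: sum_product sum.cartesian_product power_add split_def)
  also have "\<dots> = (\<Sum>x\<in>K + A. w ^ x)"
    unfolding sums[symmetric] sum.reindex[OF inj] by simp
  also have "\<dots> = (\<Sum>x\<in>K + A. w ^ (x mod m))"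
    by (intro sum.cong refl root_of_unity_power_cong[OF m(2)]) (simp add: cong_def)
  also have "\<dots> = (\<Sum>r<m. w ^ r)"
    by (rule sum.reindex_bij_betw[OF bij])
  also have "\<dots> = 0"
    using m by (simp add: geometric_sum)
  finally show ?thesis .
qed

text \<open>
  Non-divisibility only provides one primitive \<open>s\<close>-th root of unity \<open>u\<close> at which the sum over \<open>A\<close>
  is nonzero and hence the sum over \<open>K\<close> is zero; Galois conjugation carries this zero to the
  primitive root of exponent \<open>e\<close>.
\<close>

lemma exponential_sum_vanishes_at_period:
  fixes e :: int
  assumes "m > 0" "finite K" "unique_sums K A" "complete_residue_system m (K + A)"
    and s: "s > 1" "s dvd m" and e: "coprime e (int s)"
    and ndvd: "\<not> cyclotomic_poly s dvd set_poly A"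
  shows "(\<Sum>k\<in>K. cis (2 * pi * of_int e / real s) ^ k) = 0"
proof -
  obtain k where k: "coprime k s" "poly (set_poly A) (cis (2 * pi * real k / real s)) \<noteq> 0"
    using cyclotomic_dvdI[OF s(1)] ndvd by blast
  define u where "u = cis (2 * pi * real k / real s)"
  have us: "u ^ s = 1"
  proof -
    have "real s * (2 * pi * real k / real s) = 2 * pi * real k"
      using s(1) by simp
    then show ?thesis
      unfolding u_def DeMoivre by (simp only: cis_multiple_2pi Ints_of_nat)
  qed
  have um: "u ^ m = 1"
    using s(2) us by (auto simp: power_mult)
  have "u \<noteq> 1"
  proof
    assume "u = 1"
    define v where "v = cis (2 * pi * real 1 / real s)"
    have vk: "u = v ^ k"
      unfolding u_def v_def DeMoivre by (simp add: mult_ac)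
    have vs: "v ^ s = 1"
      using s(1) unfolding v_def DeMoivre by simp
    obtain k' where k': "[k * k' = 1] (mod s)"
      using cong_solve_coprime_nat[OF k(1)] by auto
    have "v ^ (k * k') = v ^ 1"
      by (rule root_of_unity_power_cong[OF vs k'])
    then have "v = cis (2 * pi * real 0 / real s)"
      using \<open>u = 1\<close> by (simp add: power_mult flip: vk)
    moreover have inj: "inj_on (\<lambda>j. cis (2 * pi * real j / real s)) {..<s}"
      using bij_betw_roots_unity[of s] s(1) by (simp add: bij_betw_def)
    ultimately have "(1::nat) = 0"
      using s(1) unfolding v_def by (intro inj_onD[OF inj]) auto
    then show False by simp
  qed
  then have "(\<Sum>k\<in>K. u ^ k) * (\<Sum>a\<in>A. u ^ a) = 0"
    using assms um by (intro root_of_unity_exponential_sums_product[of m]) auto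
  moreover have "poly (set_poly A) u = (\<Sum>a\<in>A. u ^ a)"
    by (simp add: set_poly_def poly_sum poly_monom)
  ultimately have K0: "(\<Sum>k\<in>K. u ^ k) = 0"
    using k(2) by (auto simp: u_def)
  obtain k' where k': "[int k * k' = 1] (mod int s)"
    using cong_solve_coprime_int[of "int k" "int s"] k(1) by auto
  \<comment> \<open>With \<open>k'\<close> inverse to \<open>k\<close> modulo \<open>s\<close>, the power \<open>t\<close> sends the exponent \<open>k\<close> of \<open>u\<close> to \<open>e\<close>.\<close>
  define t where "t = nat (k' * e mod int s)"
  have t: "int t = k' * e mod int s"
    unfolding t_def using s(1) by simp
  have "coprime k' (int s)"
    using k' by (metis coprime_iff_invertible_int mult.commute)
  then have "coprime (int t) (int s)"
    unfolding t using e s(1) by simp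
  then have "coprime t s" by simp
  define Q :: "int poly" where "Q = (\<Sum>k\<in>K. monom 1 k)"
  have Q: "eval_int_poly Q z = (\<Sum>k\<in>K. z ^ k)" for z
    by (simp add: Q_def hom_distribs poly_sum poly_monom)
  have "eval_int_poly Q (u ^ t) = 0"
    using s(1) us \<open>coprime t s\<close> K0
    by (intro int_poly_vanishes_at_conjugate_root_of_unity[of s]) (auto simp: Q)
  moreover have "u ^ t = cis (2 * pi * of_int e / real s)"
  proof -
    have "[int k * int t = int k * (k' * e)] (mod int s)"
      unfolding t by (intro cong_mult) (auto simp: cong_def)
    also have "[int k * (k' * e) = e] (mod int s)"
      using cong_mult[OF k' cong_refl[of e]] by (simp add: mult_ac)
    finally obtain l where "int k * int t = e + int s * l"
      by (metis cong_iff_lin mult.commute cong_sym)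
    then have kt: "real k * real t = of_int e + real s * of_int l"
      by (metis of_int_add of_int_mult of_int_of_nat_eq)
    have "real t * (2 * pi * real k / real s) = 2 * pi * (real k * real t) / real s"
      by simp
    also have "\<dots> = 2 * pi * of_int e / real s + 2 * pi * of_int l"
      unfolding kt using s(1) by (simp add: distrib_left add_divide_distrib)
    finally have "real t * (2 * pi * real k / real s) = 2 * pi * of_int e / real s + 2 * pi * of_int l" .
    then show ?thesis
      unfolding u_def DeMoivre by (simp add: cis_mult[symmetric] cis_multiple_2pi)
  qed
  ultimately show ?thesis
    by (simp add: Q)
qed

section \<open>Orthogonality of the rows\<close>

text \<open>
  Cancelling \<open>g = gcd(m, j - j')\<close> writes the root of unity of exponent \<open>j - j'\<close> modulo \<open>m\<close> as a
  primitive root of order \<open>s = m / g\<close>, an order to which the hypothesis on \<open>A\<close> applies.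
\<close>

lemma distinct_rows_character_sum:
  assumes "m \<ge> 1" "J \<subseteq> {0..<m}" "finite K" "unique_sums K A" "complete_residue_system m (K + A)"
    and ndvd: "\<And>s. s \<in> period_set m J - {1} \<Longrightarrow> \<not> cyclotomic_poly s dvd set_poly A"
    and j: "j \<in> J" "j' \<in> J" "j \<noteq> j'"
  shows "(\<Sum>k\<in>K. cis (2 * pi * of_int (int j - int j') / real m) ^ k) = 0"
proof -
  define d where "d = int j - int j'"
  define g where "g = gcd (int m) d"
  have gpos: "g > 0"
    unfolding g_def using assms(1) by (simp add: gcd_pos_int)
  define s where "s = m div nat g"
  obtain e where e: "d = g * e"
    unfolding g_def by (meson dvdE gcd_dvd2)
  have "nat g dvd m"
    unfolding g_def by (metis gcd_dvd1 gpos g_def int_dvd_int_iff int_nat_eq less_imp_le)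
  then have mgs: "m = nat g * s"
    unfolding s_def by simp
  then have mgs': "int m = g * int s"
    using gpos by simp
  have "s \<in> period_set m J"
    unfolding period_set_def difference_set_def s_def g_def d_def using j by blast
  moreover have "s \<noteq> 1"
  proof
    assume "s = 1"
    then have "int m dvd d" using e mgs' by simp
    moreover have "j < m" "j' < m"
      using j assms(2) by auto
    then have "\<bar>d\<bar> < int m" "d \<noteq> 0"
      using j(3) unfolding d_def by auto
    ultimately show False
      using zdvd_imp_le[of "int m" "\<bar>d\<bar>"] by simp
  qed
  ultimately have nd: "\<not> cyclotomic_poly s dvd set_poly A"
    using ndvd by blast
  have s1: "s > 1"
    using mgs assms(1) \<open>s \<noteq> 1\<close> by (cases s) auto
  have "g = gcd (g * int s) (g * e)"
    unfolding mgs'[symmetric] e[symmetric] by (rule g_def)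
  also have "\<dots> = g * gcd (int s) e"
    using gpos gcd_mult_distrib_int[of g "int s" e] by simp
  finally have "gcd (int s) e = 1"
    using gpos by simp
  then have cop: "coprime e (int s)"
    by (simp add: coprime_iff_gcd_eq_1 gcd.commute)
  have sm: "s dvd m"
    by (subst mgs) (rule dvd_triv_right)
  have "m > 0" using assms(1) by simp
  from exponential_sum_vanishes_at_period[OF this assms(3,4,5) s1 sm cop nd]
  have "(\<Sum>k\<in>K. cis (2 * pi * of_int e / real s) ^ k) = 0" .
  moreover have "of_int d / real m = of_int e / real s"
  proof -
    have "real m = of_int g * real s"
      using mgs' by (metis of_int_mult of_int_of_nat_eq)
    then show ?thesis using e gpos by simp
  qed
  ultimately show ?thesis
    unfolding d_def[symmetric] by (simp flip: times_divide_eq_right)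
qed

text \<open>
  Orthogonality of the columns comes for free: up to the factor \<open>n\<close>, the adjoint is a right inverse
  of the square matrix \<open>H\<close>, hence also a left inverse.
\<close>

lemma hadamard_matI_rows:
  assumes H: "H \<in> carrier_mat n n" and "n > 0"
    and unimodular: "\<And>i j. i < n \<Longrightarrow> j < n \<Longrightarrow> cmod (H $$ (i, j)) = 1"
    and orthogonal: "\<And>i i'. i < n \<Longrightarrow> i' < n \<Longrightarrow> i \<noteq> i' \<Longrightarrow> (\<Sum>j<n. H $$ (i, j) * cnj (H $$ (i', j))) = 0"
  shows "hadamard_mat n H"
proof -
  have adj: "mat_adjoint H \<in> carrier_mat n n"
    using H by (intro carrier_matI) (auto simp: mat_adjoint_def)
  have adj_index: "mat_adjoint H $$ (j, i) = cnj (H $$ (i, j))" if "i < n" "j < n" for i j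
    using H that by (simp add: mat_adjoint_def mat_of_rows_index)
  have rows: "H * mat_adjoint H = of_nat n \<cdot>\<^sub>m 1\<^sub>m n"
  proof (rule eq_matI)
    fix i i' assume i: "i < dim_row (of_nat n \<cdot>\<^sub>m 1\<^sub>m n :: complex mat)" "i' < dim_col (of_nat n \<cdot>\<^sub>m 1\<^sub>m n :: complex mat)"
    then have i: "i < n" "i' < n" by auto
    then have "(H * mat_adjoint H) $$ (i, i') = (\<Sum>j<n. H $$ (i, j) * cnj (H $$ (i', j)))"
      using H adj by (auto simp: scalar_prod_def adj_index atLeast0LessThan intro!: sum.cong)
    also have "\<dots> = (if i = i' then of_nat n else 0)"
      using orthogonal i unimodular by (auto simp: complex_norm_square[symmetric])
    finally show "(H * mat_adjoint H) $$ (i, i') = (of_nat n \<cdot>\<^sub>m 1\<^sub>m n) $$ (i, i')"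
      using i by auto
  qed (use H adj in auto)
  let ?c = "1 / of_nat n :: complex"
  have "H * (?c \<cdot>\<^sub>m mat_adjoint H) = ?c \<cdot>\<^sub>m (of_nat n \<cdot>\<^sub>m 1\<^sub>m n)"
    using H adj rows by (simp add: mult_smult_distrib)
  also have "\<dots> = 1\<^sub>m n"
    using \<open>n > 0\<close> by (intro eq_matI) auto
  finally have "(?c \<cdot>\<^sub>m mat_adjoint H) * H = 1\<^sub>m n"
    using H adj by (auto intro: mat_mult_left_right_inverse[of H n "?c \<cdot>\<^sub>m mat_adjoint H"])
  then have "?c \<cdot>\<^sub>m (mat_adjoint H * H) = 1\<^sub>m n"
    using H adj by (simp add: mult_smult_assoc_mat)
  then have "of_nat n \<cdot>\<^sub>m (?c \<cdot>\<^sub>m (mat_adjoint H * H)) = of_nat n \<cdot>\<^sub>m 1\<^sub>m n"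
    by simp
  moreover have "of_nat n \<cdot>\<^sub>m (?c \<cdot>\<^sub>m (mat_adjoint H * H)) = mat_adjoint H * H"
    using \<open>n > 0\<close> by (intro eq_matI) auto
  ultimately have "mat_adjoint H * H = of_nat n \<cdot>\<^sub>m 1\<^sub>m n"
    by simp
  with rows H unimodular show ?thesis
    unfolding hadamard_mat_def by blast
qed

lemma bij_betw_pick:
  assumes "finite I"
  shows "bij_betw (pick I) {..<card I} I"
proof -
  have "inj_on (pick I) {..<card I}"
    by (rule linorder_inj_onI') (metis lessThan_iff less_irrefl pick_mono_le)
  moreover have "pick I ` {..<card I} \<subseteq> I"
    using pick_in_set_le by auto
  ultimately show ?thesis
    using assms by (simp add: bij_betw_def card_image card_subset_eq)
qed

theorem theorem2p4:
  fixes m :: nat and J K A :: "nat set"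
  assumes "m \<ge> 1"
    and "J \<subseteq> {0..<m}" and "K \<subseteq> {0..<m}"
    and "J \<noteq> {}" and "K \<noteq> {}"
    and "card J = card K"
    and "unique_sums K A"
    and "complete_residue_system m (K + A)"
    and "\<And>s. s \<in> period_set m J - {1} \<Longrightarrow> \<not> cyclotomic_poly s dvd set_poly A"
  shows "hadamard_mat (card J) (fourier_submat m J K)"
proof -
  let ?H = "fourier_submat m J K" and ?n = "card J"
  have fin: "finite J" "finite K"
    using assms(2,3) by (auto intro: finite_subset)
  have rows: "{i. i < m \<and> i \<in> J} = J" and cols: "{i. i < m \<and> i \<in> K} = K"
    using assms(2,3) by auto
  have H: "?H \<in> carrier_mat ?n ?n"
    by (intro carrier_matI) (simp_all add: dim_submatrix fourier_mat_def rows cols assms(6))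
  have bijJ: "bij_betw (pick J) {..<?n} J" and bijK: "bij_betw (pick K) {..<?n} K"
    using bij_betw_pick[OF fin(1)] bij_betw_pick[OF fin(2)] assms(6) by simp_all
  have entry: "?H $$ (i, l) = cis (2 * pi * real (pick J i) / real m) ^ pick K l"
    if "i < ?n" "l < ?n" for i l
  proof -
    have "pick J i \<in> J" "pick K l \<in> K"
      using that bijJ bijK by (auto dest: bij_betwE)
    then have "pick J i < m" "pick K l < m"
      using assms(2,3) by auto
    then have "?H $$ (i, l) = exp (2 * of_real pi * \<i> * of_nat (pick J i) * of_nat (pick K l) / of_nat m)"
      using that assms(6)
      by (subst submatrix_index) (simp_all add: fourier_mat_def rows cols)
    also have "\<dots> = cis (2 * pi * real (pick J i) / real m) ^ pick K l"
      unfolding DeMoivre by (simp add: cis_conv_exp mult_ac)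
    finally show ?thesis .
  qed
  show ?thesis
  proof (rule hadamard_matI_rows[OF H])
    show "?n > 0"
      using fin(1) assms(4) by (simp add: card_gt_0_iff)
    show "cmod (?H $$ (i, l)) = 1" if "i < ?n" "l < ?n" for i l
      using that by (simp add: entry norm_power)
    fix i i' assume i: "i < ?n" "i' < ?n" "i \<noteq> i'"
    let ?w = "cis (2 * pi * of_int (int (pick J i) - int (pick J i')) / real m)"
    have "?H $$ (i, l) * cnj (?H $$ (i', l)) = ?w ^ pick K l" if "l < ?n" for l
      using that i by (simp add: entry cis_cnj cis_mult flip: power_mult_distrib)
        (simp add: diff_divide_distrib algebra_simps)
    then have "(\<Sum>l<?n. ?H $$ (i, l) * cnj (?H $$ (i', l))) = (\<Sum>l<?n. ?w ^ pick K l)"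
      by simp
    also have "\<dots> = (\<Sum>k\<in>K. ?w ^ k)"
      by (rule sum.reindex_bij_betw[OF bijK])
    also have "\<dots> = 0"
    proof (rule distinct_rows_character_sum[OF assms(1,2) fin(2) assms(7,8,9)])
      show "pick J i \<in> J" "pick J i' \<in> J"
        using i bijJ by (auto dest: bij_betwE)
      show "pick J i \<noteq> pick J i'"
        using i bijJ by (auto simp: bij_betw_def inj_on_def)
    qed
    finally show "(\<Sum>l<?n. ?H $$ (i, l) * cnj (?H $$ (i', l))) = 0" .
  qed
qed

end
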